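(* Let $R$ be a nonzero homogeneous polynomial of degree $d$ in $n$ variables whose coefficients are real. Then $R$ is a critical point of $\|\mathfrak m\|^2$, regarded as a function of the real and imaginary parts of the coefficients of nonzero complex homogeneous polynomials of degree $d$ in $n$ variables, if and only if $R$ is a real critical point of $\|\mathfrak m\|^2$, i.e. a critical point of the restriction of $\|\mathfrak m\|^2$ to nonzero homogeneous polynomials of degree $d$ in $n$ variables with real coefficients, regarded as a function of those real coefficients.
   Context: Let $n,d\ge1$. For $\alpha\in\mathbb Z_{\ge0}^n$ write $m^\alpha=x_1^{\alpha_1}\cdots x_n^{\alpha_n}$. For each $e\ge0$, on the complex vector space of homogeneous polynomials of degree $e$ in $x_1,\dots,x_n$, let $\langle\,,\,\rangle$ be the hermitian product (linear in the first argument) for which the monomials $m^\alpha$ with $\alpha_1+\cdots+\alpha_n=e$ are orthogonal and $\|m^\alpha\|^2=\frac{\alpha_1!\cdots\alpha_n!}{e!}$; write $\|f\|^2=\langle f,f\rangle$. For a nonzero complex homogeneous polynomial $f$ of degree $d$, let $H(f)$ be the $n\times n$ hermitian matrix whose $(i,j)$-th entry is $\frac{1}{\|f\|^2}\cdot\frac1d\left\langle\frac{\partial f}{\partial x_j},\frac{\partial f}{\partial x_i}\right\rangle$, and let the moment matrix be $\mathfrak m(f)=2\left(H(f)-\frac dn I\right)$, with $I$ the identity matrix. Its square length is $\|\mathfrak m\|^2(f)=\mathrm{Re}\,(\mathrm{Tr}(\mathfrak m(f)\,\mathfrak m(f)))$. This function is invariant under scaling $f$ by nonzero complex numbers, so it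 is a function on the projective space of such polynomials. A critical point is a point at which all partial derivatives of the function with respect to the indicated real parameters vanish. *)

theory Defs
  imports "HOL-Analysis.Analysis" "HOL-Library.Poly_Mapping"
begin

text \<open>
  Polynomials in finitely many variables \<open>x\<^sub>i\<close>, \<open>i :: 'n::finite\<close>, so that the number of
  variables is \<open>CARD('n)\<close>. A polynomial is the finitely supported map from exponent vectors to
  coefficients; \<open>Poly_Mapping.single \<alpha> c\<close> is the term \<open>c x\<^sup>\<alpha>\<close>.
\<close>

type_synonym 'n expo = "'n \<Rightarrow>\<^sub>0 nat"
type_synonym ('n, 'a) mpoly = "'n expo \<Rightarrow>\<^sub>0 'a"

definition total_deg :: "'n::finite expo \<Rightarrow> nat" where
  "total_deg \<alpha> = (\<Sum>i\<in>UNIV. Poly_Mapping.lookup \<alpha> i)"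

definition expo_fact :: "'n::finite expo \<Rightarrow> nat" where
  "expo_fact \<alpha> = (\<Prod>i\<in>UNIV. fact (Poly_Mapping.lookup \<alpha> i))"

definition homogeneous :: "nat \<Rightarrow> ('n::finite, 'a::zero) mpoly \<Rightarrow> bool" where
  "homogeneous e f \<longleftrightarrow> (\<forall>\<alpha>\<in>Poly_Mapping.keys f. total_deg \<alpha> = e)"

text \<open>
  The subtraction of exponents is truncated, but it is only truncated in terms with
  coefficient \<open>0\<close>.
\<close>

definition partial_deriv :: "'n \<Rightarrow> ('n::finite, 'a::comm_semiring_1) mpoly \<Rightarrow> ('n, 'a) mpoly" where
  "partial_deriv i f = (\<Sum>\<alpha>\<in>Poly_Mapping.keys f.
     Poly_Mapping.single (\<alpha> - Poly_Mapping.single i 1)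
       (of_nat (Poly_Mapping.lookup \<alpha> i) * Poly_Mapping.lookup f \<alpha>))"

definition complexify :: "('n, real) mpoly \<Rightarrow> ('n, complex) mpoly" where
  "complexify = Poly_Mapping.map complex_of_real"

text \<open>
  The hermitian product on homogeneous polynomials of degree \<open>e\<close>, linear in the first argument;
  see \<open>herm_single\<close> below for its values on monomials.
\<close>

definition herm :: "nat \<Rightarrow> ('n::finite, complex) mpoly \<Rightarrow> ('n, complex) mpoly \<Rightarrow> complex" where
  "herm e f g = (\<Sum>\<alpha> | total_deg \<alpha> = e. of_real (real (expo_fact \<alpha>) / fact e)
     * Poly_Mapping.lookup f \<alpha> * cnj (Poly_Mapping.lookup g \<alpha>))"

definition H_matrix :: "nat \<Rightarrow> ('n::finite, complex) mpoly \<Rightarrow> complex ^ 'n ^ 'n" where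
  "H_matrix d f = (\<chi> i j. 1 / herm d f f * (1 / of_nat d
     * herm (d - 1) (partial_deriv j f) (partial_deriv i f)))"

definition moment_matrix :: "nat \<Rightarrow> ('n::finite, complex) mpoly \<Rightarrow> complex ^ 'n ^ 'n" where
  "moment_matrix d f =
     2 *\<^sub>R (H_matrix d f - (real d / real CARD('n)) *\<^sub>R mat 1)"

definition moment_sq :: "nat \<Rightarrow> ('n::finite, complex) mpoly \<Rightarrow> real" where
  "moment_sq d f = Re (trace (moment_matrix d f ** moment_matrix d f))"

text \<open>
  The real parameters are the real and imaginary parts of the coefficients of the monomials of
  degree \<open>d\<close>. The partial derivative with respect to one of them is the derivative at \<open>0\<close> along the
  line that changes this parameter only. For \<open>f \<noteq> 0\<close> this line avoids the zero polynomial near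
  \<open>0\<close>, so the value of \<open>moment_sq\<close> at the zero polynomial plays no role.
\<close>

definition critical_point :: "nat \<Rightarrow> ('n::finite, complex) mpoly \<Rightarrow> bool" where
  "critical_point d f \<longleftrightarrow> (\<forall>\<alpha>. total_deg \<alpha> = d \<longrightarrow>
     ((\<lambda>t::real. moment_sq d (f + Poly_Mapping.single \<alpha> (of_real t)))
        has_real_derivative 0) (at 0) \<and>
     ((\<lambda>t::real. moment_sq d (f + Poly_Mapping.single \<alpha> (\<i> * of_real t)))
        has_real_derivative 0) (at 0))"

definition real_critical_point :: "nat \<Rightarrow> ('n::finite, real) mpoly \<Rightarrow> bool" where
  "real_critical_point d R \<longleftrightarrow> (\<forall>\<alpha>. total_deg \<alpha> = d \<longrightarrow>
     ((\<lambda>t::real. moment_sq d (complexify (R + Poly_Mapping.single \<alpha> t)))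
        has_real_derivative 0) (at 0))"

lemma finite_total_deg: "finite {\<alpha> :: 'n::finite expo. total_deg \<alpha> = e}"
proof -
  let ?F = "PiE (UNIV :: 'n set) (\<lambda>_. {..e})"
  have "Poly_Mapping.lookup ` {\<alpha> :: 'n expo. total_deg \<alpha> = e} \<subseteq> ?F"
  proof (clarsimp simp: PiE_UNIV_domain)
    fix \<alpha> :: "'n expo" and i :: 'n
    show "Poly_Mapping.lookup \<alpha> i \<le> total_deg \<alpha>"
      unfolding total_deg_def by (rule member_le_sum) auto
  qed
  moreover have "finite ?F"
    by (rule finite_PiE) auto
  ultimately have "finite (Poly_Mapping.lookup ` {\<alpha> :: 'n expo. total_deg \<alpha> = e})"
    by (rule finite_subset)
  then show ?thesis
    by (rule finite_imageD) (simp add: inj_on_def)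
qed

lemma herm_single:
  assumes "total_deg \<alpha> = e" "total_deg \<beta> = e"
  shows "herm e (Poly_Mapping.single \<alpha> 1) (Poly_Mapping.single \<beta> 1) =
    (if \<alpha> = \<beta> then of_real (real (expo_fact \<alpha>) / fact e) else 0)"
proof -
  have "herm e (Poly_Mapping.single \<alpha> 1) (Poly_Mapping.single \<beta> 1) =
    (\<Sum>\<gamma> | total_deg \<gamma> = e. if \<gamma> = \<alpha> then
       (if \<alpha> = \<beta> then of_real (real (expo_fact \<alpha>) / fact e) else 0) else 0)"
    unfolding herm_def by (rule sum.cong) (simp_all add: lookup_single when_def)
  also have "\<dots> = (if \<alpha> = \<beta> then of_real (real (expo_fact \<alpha>) / fact e) else 0)"
    using assms by (simp add: finite_total_deg)
  finally show ?thesis .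
qed

lemma lookup_complexify:
  "Poly_Mapping.lookup (complexify f) \<alpha> = of_real (Poly_Mapping.lookup f \<alpha>)"
  by (simp add: complexify_def Poly_Mapping.map.rep_eq when_def)

end

theory Submission
  imports Defs
begin

text \<open>
  The function \<open>moment_sq\<close> is invariant under complex conjugation of the coefficients: conjugating
  \<open>f\<close> conjugates every entry of the moment matrix, and only the real part of the trace is taken.
  A polynomial \<open>R\<close> with real coefficients is fixed by this symmetry. Conjugation also fixes the
  real coefficient directions and reverses the imaginary ones. Along an imaginary direction
  through \<open>R\<close> the function \<open>moment_sq\<close> is therefore even, so its derivative there vanishes as soon
  as it exists (\<open>even_has_derivative_zero\<close>). Existence holds because the entries of the moment
  matrix are quotients of polynomials in the real parameter whose common denominator, the square
  of the norm, does not vanish at \<open>R\<close> (\<open>moment_sq_differentiable\<close>).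

  Hence the imaginary half of the conditions for a critical point is automatic at \<open>R\<close>, and the
  remaining half is the condition for a real critical point.
\<close>

text \<open>
  The hermitian products of partial derivatives are controlled through this coefficient formula:
  of all exponents \<open>\<alpha>\<close> with \<open>\<alpha> - e\<^sub>i = \<beta>\<close> in truncated subtraction, those with \<open>\<alpha>\<^sub>i = 0\<close> carry the
  factor \<open>0\<close>, so that only \<open>\<beta> + e\<^sub>i\<close> contributes.
\<close>

lemma lookup_partial_deriv:
  fixes f :: "('n::finite, 'a::comm_semiring_1) mpoly"
  shows "Poly_Mapping.lookup (partial_deriv i f) \<beta> =
    of_nat (Suc (Poly_Mapping.lookup \<beta> i))
      * Poly_Mapping.lookup f (\<beta> + Poly_Mapping.single i 1)"
proof -
  let ?e = "Poly_Mapping.single i (1::nat)"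
  let ?c = "of_nat (Suc (Poly_Mapping.lookup \<beta> i)) * Poly_Mapping.lookup f (\<beta> + ?e)"
  have term_eq: "Poly_Mapping.lookup (Poly_Mapping.single (\<alpha> - ?e)
      (of_nat (Poly_Mapping.lookup \<alpha> i) * Poly_Mapping.lookup f \<alpha>)) \<beta>
    = (if \<alpha> = \<beta> + ?e then ?c else 0)" for \<alpha>
  proof (cases "Poly_Mapping.lookup \<alpha> i = 0")
    case True
    then have "\<alpha> \<noteq> \<beta> + ?e"
      by (auto simp: lookup_add)
    with True show ?thesis
      by simp
  next
    case False
    then have "\<alpha> = (\<alpha> - ?e) + ?e"
      by (intro poly_mapping_eqI) (auto simp: lookup_add lookup_minus lookup_single when_def)
    then have "\<alpha> - ?e = \<beta> \<longleftrightarrow> \<alpha> = \<beta> + ?e"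
      by (metis add_diff_cancel_right')
    then show ?thesis
      by (auto simp: lookup_single when_def lookup_add)
  qed
  have "Poly_Mapping.lookup (partial_deriv i f) \<beta> =
      (\<Sum>\<alpha>\<in>Poly_Mapping.keys f. if \<alpha> = \<beta> + ?e then ?c else 0)"
    unfolding partial_deriv_def lookup_sum by (rule sum.cong[OF refl]) (rule term_eq)
  also have "\<dots> = ?c"
    by (auto simp: in_keys_iff)
  finally show ?thesis .
qed

lemma trace_square:
  fixes A :: "'a::semiring_1 ^ 'n ^ 'n"
  shows "trace (A ** A) = (\<Sum>i\<in>UNIV. \<Sum>j\<in>UNIV. A $ i $ j * A $ j $ i)"
  by (simp add: trace_def matrix_matrix_mult_def)

lemma moment_matrix_nth:
  fixes f :: "('n::finite, complex) mpoly"
  shows "moment_matrix d f $ i $ j =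
    2 * (1 / herm d f f * (1 / of_nat d * herm (d - 1) (partial_deriv j f) (partial_deriv i f))
      - of_real (if i = j then real d / real CARD('n) else 0))"
  by (simp add: moment_matrix_def H_matrix_def mat_def scaleR_conv_of_real[of _ "_ :: complex"])

lemma herm_conjugate:
  assumes "\<And>\<alpha>. Poly_Mapping.lookup f' \<alpha> = cnj (Poly_Mapping.lookup f \<alpha>)"
    and "\<And>\<alpha>. Poly_Mapping.lookup g' \<alpha> = cnj (Poly_Mapping.lookup g \<alpha>)"
  shows "herm e f' g' = cnj (herm e f g)"
  by (simp add: herm_def assms)

text \<open>
  The denominator \<open>herm d f f\<close> and the multiple of the identity are real, and conjugation commutes
  with differentiation, whose factors are natural numbers; so the whole matrix is conjugated.
\<close>

lemma moment_sq_conjugate: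
  fixes f g :: "('n::finite, complex) mpoly"
  assumes g: "\<And>\<alpha>. Poly_Mapping.lookup g \<alpha> = cnj (Poly_Mapping.lookup f \<alpha>)"
  shows "moment_sq d g = moment_sq d f"
proof -
  have deriv: "Poly_Mapping.lookup (partial_deriv i g) \<alpha>
      = cnj (Poly_Mapping.lookup (partial_deriv i f) \<alpha>)" for i \<alpha>
    by (simp add: lookup_partial_deriv g)
  have "moment_matrix d g $ i $ j = cnj (moment_matrix d f $ i $ j)" for i j
    by (simp add: moment_matrix_nth herm_conjugate[OF g g] herm_conjugate[OF deriv deriv])
  then have "trace (moment_matrix d g ** moment_matrix d g)
      = cnj (trace (moment_matrix d f ** moment_matrix d f))"
    by (simp add: trace_square)
  then show ?thesis
    by (simp add: moment_sq_def)
qed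

lemma herm_self_nonzero:
  assumes "total_deg \<alpha> = d" "Poly_Mapping.lookup f \<alpha> \<noteq> 0"
  shows "herm d f f \<noteq> 0"
proof -
  let ?r = "\<lambda>\<beta>. real (expo_fact \<beta>) / fact d * (cmod (Poly_Mapping.lookup f \<beta>))\<^sup>2"
  have eq: "herm d f f = of_real (\<Sum>\<beta> | total_deg \<beta> = d. ?r \<beta>)"
    unfolding herm_def of_real_sum
    by (rule sum.cong) (simp_all only: of_real_mult complex_norm_square mult.assoc)
  have pos: "0 < (\<Sum>\<beta> | total_deg \<beta> = d. ?r \<beta>)"
  proof (rule sum_pos2[OF finite_total_deg])
    show "\<alpha> \<in> {\<beta>. total_deg \<beta> = d}"
      using assms by simp
    have "0 < expo_fact \<alpha>"
      unfolding expo_fact_def by (rule prod_pos) simp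
    then show "0 < ?r \<alpha>"
      using assms by simp
  qed simp
  show ?thesis
    unfolding eq of_real_eq_0_iff by (rule less_imp_neq[OF pos, symmetric])
qed

lemma herm_differentiable:
  fixes F G :: "real \<Rightarrow> ('n::finite, complex) mpoly"
  assumes "\<And>\<alpha>. (\<lambda>t. Poly_Mapping.lookup (F t) \<alpha>) differentiable (at x)"
    and "\<And>\<alpha>. (\<lambda>t. Poly_Mapping.lookup (G t) \<alpha>) differentiable (at x)"
  shows "(\<lambda>t. herm e (F t) (G t)) differentiable (at x)"
proof -
  have "(\<lambda>t. cnj (Poly_Mapping.lookup (G t) \<alpha>)) differentiable (at x)" for \<alpha>
    using assms(2)[of \<alpha>] bounded_linear.has_derivative[OF bounded_linear_cnj]
    unfolding differentiable_def by blast
  then show ?thesis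
    unfolding herm_def
    by (intro differentiable_sum differentiable_mult differentiable_const assms finite_total_deg ballI)
qed

text \<open>
  By \<open>lookup_partial_deriv\<close> the partial derivatives of a curve with differentiable coefficients
  are again such curves, so \<open>herm_differentiable\<close> applies to the numerators of the entries of the
  moment matrix as well as to their denominator.
\<close>

lemma moment_sq_differentiable:
  fixes F :: "real \<Rightarrow> ('n::finite, complex) mpoly"
  assumes F: "\<And>\<alpha>. (\<lambda>t. Poly_Mapping.lookup (F t) \<alpha>) differentiable (at x)"
    and nz: "herm d (F x) (F x) \<noteq> 0"
  shows "(\<lambda>t. moment_sq d (F t)) differentiable (at x)"
proof -
  have deriv: "(\<lambda>t. Poly_Mapping.lookup (partial_deriv i (F t)) \<alpha>) differentiable (at x)" for i \<alpha>
    unfolding lookup_partial_deriv by (intro differentiable_mult differentiable_const F)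
  have entry: "(\<lambda>t. moment_matrix d (F t) $ i $ j) differentiable (at x)" for i j
    unfolding moment_matrix_nth
    by (intro differentiable_mult differentiable_diff differentiable_divide differentiable_const
        herm_differentiable F deriv nz)
  have "(\<lambda>t. trace (moment_matrix d (F t) ** moment_matrix d (F t))) differentiable (at x)"
    unfolding trace_square
    by (intro differentiable_sum differentiable_mult entry finite ballI)
  then show ?thesis
    using bounded_linear.has_derivative[OF bounded_linear_Re]
    unfolding differentiable_def moment_sq_def by blast
qed

lemma even_has_derivative_zero:
  fixes g :: "real \<Rightarrow> real"
  assumes "g differentiable (at 0)" and even: "\<And>t. g (- t) = g t"
  shows "(g has_real_derivative 0) (at 0)"
proof -
  obtain D where D: "(g has_real_derivative D) (at 0)"
    using assms(1) real_differentiable_def by blast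
  then have "((\<lambda>t. g (- t)) has_real_derivative - D) (at 0)"
    using DERIV_mirror[of g D 0] by simp
  then have "- D = D"
    using D DERIV_unique unfolding even by blast
  with D show ?thesis
    by simp
qed

text \<open>
  Conjugation reflects the line \<open>R + \<i>t x\<^sup>\<alpha>\<close> at \<open>R\<close>, that is, it replaces \<open>t\<close> by \<open>- t\<close>.
\<close>

lemma moment_sq_imaginary_direction:
  fixes R :: "('n::finite, real) mpoly"
  assumes "herm d (complexify R) (complexify R) \<noteq> 0"
  shows "((\<lambda>t::real. moment_sq d (complexify R + Poly_Mapping.single \<alpha> (\<i> * of_real t)))
    has_real_derivative 0) (at 0)"
proof (rule even_has_derivative_zero)
  have line: "(\<lambda>t. Poly_Mapping.lookup
      (complexify R + Poly_Mapping.single \<alpha> (\<i> * of_real t)) \<beta>) differentiable (at 0)" for \<beta>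
  proof -
    have "complex_of_real differentiable (at 0)"
      using bounded_linear_imp_differentiable[OF bounded_linear_of_real] .
    then show ?thesis
      by (cases "\<alpha> = \<beta>") (simp_all add: lookup_add lookup_single when_def)
  qed
  show "(\<lambda>t::real. moment_sq d (complexify R + Poly_Mapping.single \<alpha> (\<i> * of_real t)))
      differentiable (at 0)"
    by (rule moment_sq_differentiable[OF line]) (simp add: assms)
  show "moment_sq d (complexify R + Poly_Mapping.single \<alpha> (\<i> * of_real (- t)))
      = moment_sq d (complexify R + Poly_Mapping.single \<alpha> (\<i> * of_real t))" for t
    by (rule moment_sq_conjugate) (simp add: lookup_add lookup_single lookup_complexify when_def)
qed

theorem theorem5p2:
  fixes R :: "('n::finite, real) mpoly" and d :: nat
  assumes "d \<ge> 1"
    and "R \<noteq> 0"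
    and "homogeneous d R"
  shows "critical_point d (complexify R) \<longleftrightarrow> real_critical_point d R"
proof -
  obtain \<alpha> where "\<alpha> \<in> Poly_Mapping.keys R"
    using assms(2) by (metis ex_in_conv keys_eq_empty)
  then have "herm d (complexify R) (complexify R) \<noteq> 0"
    using assms(3) herm_self_nonzero[of \<alpha> d "complexify R"]
    by (simp add: homogeneous_def in_keys_iff lookup_complexify)
  moreover have "complexify (R + Poly_Mapping.single \<beta> t)
      = complexify R + Poly_Mapping.single \<beta> (of_real t)" for \<beta> t
    by (rule poly_mapping_eqI) (simp add: lookup_complexify lookup_add lookup_single when_def)
  ultimately show ?thesis
    by (simp add: critical_point_def real_critical_point_def moment_sq_imaginary_direction)
qed

end
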